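(* Let $n\ge 1$ and let $\Phi_n(x)$ be the $n$-th cyclotomic polynomial. Then: (i) $2\Phi_n'''(1)$ is divisible by $\phi(n)-2$; in particular, if $\phi(n)$ is divisible by $4$, then $\Phi_n'''(1)$ is divisible by $\phi(n)-2$. (ii) For every integer $k\ge 2$, $\Phi_n^{(2k+1)}(1)$ is divisible by $\phi(n)-2k$.
   Context: $\Phi_n(x)\in\mathbb{Z}[x]$ is the $n$-th cyclotomic polynomial, of degree $\phi(n)$ (Euler's totient); $\Phi_n^{(m)}$ denotes its $m$-th derivative. Divisibility is in $\mathbb{Z}$; an integer is divisible by $0$ only if it equals $0$. *)

theory Defs
  imports
    "HOL-Computational_Algebra.Polynomial"
    "HOL-Number_Theory.Totient"
begin

definition cyclotomic_complex :: "nat \<Rightarrow> complex poly" where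
  "cyclotomic_complex n = (\<Prod>k\<in>totatives n. [:- cis (2 * pi * real k / real n), 1:])"

text \<open>
  The polynomial over the integers whose image over the complex numbers is the product above.
  It exists and is unique for every \<open>n\<close>; see \<open>of_int_cyclotomic\<close> and
  \<open>cyclotomic_unique\<close> below.
\<close>

definition cyclotomic :: "nat \<Rightarrow> int poly" where
  "cyclotomic n = (THE p. map_poly of_int p = cyclotomic_complex n)"

lemma map_poly_of_int_mult:
  "map_poly of_int (p * q) = (map_poly of_int p * map_poly of_int q :: complex poly)"
  by (rule poly_eqI) (simp add: coeff_map_poly coeff_mult)

lemma map_poly_of_int_add:
  "map_poly of_int (p + q) = (map_poly of_int p + map_poly of_int q :: complex poly)"
  by (rule poly_eqI) (simp add: coeff_map_poly)

lemma map_poly_of_int_diff: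
  "map_poly of_int (p - q) = (map_poly of_int p - map_poly of_int q :: complex poly)"
  by (rule poly_eqI) (simp add: coeff_map_poly)

lemma map_poly_of_int_prod:
  "map_poly of_int (\<Prod>x\<in>A. f x) = (\<Prod>x\<in>A. map_poly of_int (f x) :: complex poly)"
  by (induction A rule: infinite_finite_induct) (simp_all add: map_poly_of_int_mult)

lemma degree_map_poly_of_int:
  "degree (map_poly of_int p :: complex poly) = degree p"
  by (cases "p = 0") (simp_all add: map_poly_degree_eq)

lemma map_poly_of_int_inject:
  "(map_poly of_int p :: complex poly) = map_poly of_int q \<longleftrightarrow> p = q"
  by (auto simp: poly_eq_iff coeff_map_poly)

lemma degree_cyclotomic_complex: "degree (cyclotomic_complex n) = totient n"
  unfolding cyclotomic_complex_def totient_def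
  by (subst degree_prod_sum_eq) auto

lemma lead_coeff_cyclotomic_complex: "lead_coeff (cyclotomic_complex n) = 1"
  unfolding cyclotomic_complex_def by (subst lead_coeff_prod) auto

lemma prod_roots_unity:
  assumes "n > 0"
  shows "(\<Prod>k\<in>{0<..n}. [:- cis (2 * pi * real k / real n), 1:]) = monom 1 n - 1"
    (is "?P = ?Q")
proof -
  have deg: "degree ?P = n"
    by (subst degree_prod_sum_eq) auto
  have lc: "lead_coeff ?P = 1"
    by (subst lead_coeff_prod) auto
  have degQ: "degree (?Q :: complex poly) \<le> n"
    by (rule degree_diff_le) (auto simp: degree_monom_le)
  have card: "card {z::complex. z ^ n = 1} = n"
    using assms by (rule card_roots_unity_eq)
  show ?thesis
  proof (rule poly_eqI_degree_lead_coeff[where n = n and A = "{z::complex. z ^ n = 1}"])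
    show "coeff ?P n = coeff ?Q n"
      using lc deg assms by simp
    fix z :: complex
    assume "z \<in> {z. z ^ n = 1}"
    then obtain k where k: "k < n" "z = cis (2 * pi * real k / real n)"
      using bij_betw_roots_unity[OF assms] by (auto simp: bij_betw_def image_iff)
    have "\<exists>j\<in>{0<..n}. z = cis (2 * pi * real j / real n)"
    proof (cases "k = 0")
      case True
      thus ?thesis using k assms by (intro bexI[of _ n]) auto
    next
      case False
      thus ?thesis using k by (intro bexI[of _ k]) auto
    qed
    hence "poly ?P z = 0"
      by (subst poly_prod, subst prod_zero_iff) auto
    moreover have "poly ?Q z = 0"
      using \<open>z \<in> _\<close> by (simp add: poly_monom)
    ultimately show "poly ?P z = poly ?Q z" by simp
  qed (use deg degQ card in simp_all)
qed

lemma prod_cyclotomic_complex: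
  assumes "n > 0"
  shows "(\<Prod>d | d dvd n. cyclotomic_complex d) = monom 1 n - 1"
proof -
  define f where "f = (\<lambda>k. [:- cis (2 * pi * real k / real n), 1:])"
  define A where "A = (\<lambda>d. {k\<in>{0<..n}. gcd k n = d})"
  have *: "prod f (A d) = cyclotomic_complex (n div d)" if d: "d dvd n" for d
  proof -
    have "d > 0" using d assms by (auto intro!: Nat.gr0I)
    have "prod f (A d) = (\<Prod>k\<in>totatives (n div d). f (k * d))"
      unfolding A_def
      using bij_betw_totatives_gcd_eq[OF d assms]
      by (intro prod.reindex_bij_betw[symmetric]) (auto simp: mult.commute)
    also have "\<dots> = cyclotomic_complex (n div d)"
      unfolding cyclotomic_complex_def f_def
      using d \<open>d > 0\<close> assms by (intro prod.cong) (auto elim!: dvdE simp: field_simps)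
    finally show ?thesis .
  qed
  have "monom 1 n - 1 = prod f {0<..n}"
    unfolding f_def using prod_roots_unity[OF assms] by simp
  also have "{0<..n} = (\<Union>d\<in>{d. d dvd n}. A d)" by (auto simp: A_def)
  also have "prod f \<dots> = (\<Prod>d | d dvd n. prod f (A d))"
    using assms by (intro prod.UNION_disjoint) (auto simp: A_def)
  also have "\<dots> = (\<Prod>d | d dvd n. cyclotomic_complex (n div d))"
    by (intro prod.cong refl *) auto
  also have "\<dots> = (\<Prod>d | d dvd n. cyclotomic_complex d)" using assms
    by (intro prod.reindex_bij_witness[of _ "(div) n" "(div) n"]) (auto elim: dvdE)
  finally show ?thesis ..
qed

lemma cyclotomic_complex_integral: "\<exists>p. map_poly of_int p = cyclotomic_complex n"
proof (induction n rule: less_induct)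
  case (less n)
  show ?case
  proof (cases "n = 0")
    case True
    thus ?thesis by (intro exI[of _ 1]) (simp add: cyclotomic_complex_def)
  next
    case False
    hence n: "n > 0" by simp
    define D where "D = {d. d dvd n} - {n}"
    have D: "finite D" "\<And>d. d \<in> D \<Longrightarrow> d < n" "{d. d dvd n} = insert n D" "n \<notin> D"
      using n by (auto simp: D_def dest: dvd_imp_le)
    from less D(2) have "\<forall>d\<in>D. \<exists>p. map_poly of_int p = cyclotomic_complex d" by blast
    then obtain P where P: "\<And>d. d \<in> D \<Longrightarrow> map_poly of_int (P d) = cyclotomic_complex d"
      by metis
    define Q where "Q = prod P D"
    have Qc: "map_poly of_int Q = prod cyclotomic_complex D"
      unfolding Q_def map_poly_of_int_prod using P by (intro prod.cong) auto
    have "lead_coeff (map_poly of_int Q :: complex poly) = 1"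
      unfolding Qc by (simp only: lead_coeff_prod lead_coeff_cyclotomic_complex prod.neutral_const)
    hence lcQ: "lead_coeff Q = 1"
      by (simp add: degree_map_poly_of_int coeff_map_poly)
    hence Q0: "Q \<noteq> 0" by auto
    obtain q r where qr: "pseudo_divmod (monom 1 n - 1) Q = (q, r)" by (meson surj_pair)
    have eq: "monom 1 n - 1 = Q * q + r" and r: "r = 0 \<or> degree r < degree Q"
      using pseudo_divmod[OF Q0 qr] lcQ by simp_all
    have "map_poly of_int Q * cyclotomic_complex n = monom 1 n - 1"
      using prod_cyclotomic_complex[OF n] D(1,4) unfolding D(3) Qc by (simp add: mult.commute)
    also have "\<dots> = map_poly of_int (monom 1 n - 1)"
      by (simp add: map_poly_of_int_diff map_poly_monom)
    also have "\<dots> = map_poly of_int Q * map_poly of_int q + map_poly of_int r"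
      unfolding eq by (simp add: map_poly_of_int_add map_poly_of_int_mult)
    finally have *: "map_poly of_int Q * (cyclotomic_complex n - map_poly of_int q) = map_poly of_int r"
      by (simp add: algebra_simps)
    have "cyclotomic_complex n - map_poly of_int q = 0"
    proof (rule ccontr)
      assume nz: "cyclotomic_complex n - map_poly of_int q \<noteq> 0"
      have Qnz: "(map_poly of_int Q :: complex poly) \<noteq> 0"
        using Q0 map_poly_of_int_inject[of Q 0] by simp
      have "r \<noteq> 0" using * nz Qnz by auto
      moreover have "degree r = degree Q + degree (cyclotomic_complex n - map_poly of_int q)"
        using degree_mult_eq[OF Qnz nz] unfolding * by (simp add: degree_map_poly_of_int)
      ultimately show False using r by simp
    qed
    thus ?thesis by (intro exI[of _ q]) simp
  qed
qed

lemma of_int_cyclotomic: "map_poly of_int (cyclotomic n) = cyclotomic_complex n"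
  unfolding cyclotomic_def
  by (rule theI') (metis cyclotomic_complex_integral map_poly_of_int_inject)

lemma cyclotomic_unique: "map_poly of_int p = cyclotomic_complex n \<Longrightarrow> p = cyclotomic n"
  by (metis of_int_cyclotomic map_poly_of_int_inject)

lemma degree_cyclotomic: "degree (cyclotomic n) = totient n"
  by (metis of_int_cyclotomic degree_map_poly_of_int degree_cyclotomic_complex)

end

theory Submission
  imports Defs
begin

text \<open>
  For \<open>n > 2\<close> the polynomial \<open>\<Phi>\<^sub>n\<close> is palindromic of even degree \<open>2m\<close>, hence an
  integer combination of the polynomials \<open>(x - 1)\<^bsup>2i\<^esup> x\<^bsup>m-i\<^esup>\<close>. The derivative of order
  \<open>2k + 1\<close> of such a polynomial at \<open>1\<close> is \<open>(2k+1)!/(2r+1)!\<close> times the product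
  \<open>N (N-1) \<dots> (N-2r)\<close>, where \<open>N = m - i\<close> and \<open>r = k - i\<close>. The middle factor of this product is
  \<open>N - r = m - k\<close>, and a further factor \<open>2\<close> comes from the factorial quotient if \<open>i > 0\<close>, and from
  \<open>N (N-1)\<close> if \<open>i = 0\<close> and \<open>k \<ge> 2\<close>.
\<close>

section \<open>Expansion of palindromic polynomials\<close>

lemma palindromic_decomposition:
  fixes f :: "'a::comm_ring_1 poly"
  assumes "degree f \<le> 2 * m"
    and "\<And>i. i \<le> 2 * m \<Longrightarrow> coeff f i = coeff f (2 * m - i)"
  shows "\<exists>b. f = (\<Sum>i\<le>m. smult (b i) ([:-1, 1:] ^ (2 * i) * monom 1 (m - i)))"
  using assms
proof (induction m arbitrary: f)
  case 0
  then have "f = [:coeff f 0:]"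
    by (intro poly_eqI) (auto simp: coeff_pCons coeff_eq_0 split: nat.split)
  then show ?case
    by (intro exI[of _ "\<lambda>_. coeff f 0"]) simp
next
  case (Suc m)
  \<comment> \<open>The term for \<open>i = Suc m\<close>. Its exponent is even, so it is
    palindromic with constant coefficient 1.\<close>
  define q :: "'a poly" where "q = [:-1, 1:] ^ (2 * Suc m)"
  have degq: "degree q \<le> 2 * Suc m"
    unfolding q_def by (rule order.trans[OF degree_power_le]) simp
  have coeffq: "coeff q i = of_nat (2 * Suc m choose i) * (- 1) ^ i" if "i \<le> 2 * Suc m" for i
  proof -
    have "(- 1 :: 'a) ^ (2 * Suc m - i) = (- 1) ^ i"
      using that by (cases "even i") simp_all
    then show ?thesis
      using coeff_linear_poly_power[OF that, of "-1" "1::'a"] by (simp add: q_def)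
  qed
  have palq: "coeff q i = coeff q (2 * Suc m - i)" if "i \<le> 2 * Suc m" for i
  proof -
    have "(- 1 :: 'a) ^ (2 * Suc m - i) = (- 1) ^ i"
      using that by (cases "even i") simp_all
    then show ?thesis
      using that binomial_symmetric[OF that] coeffq[of i] coeffq[of "2 * Suc m - i"] by simp
  qed
  \<comment> \<open>Subtracting \<open>smult c q\<close> kills the constant coefficient and, by
    symmetry, the one at \<open>2 * Suc m\<close>. What remains is x times a palindromic
    \<open>g\<close> whose degree bound is lower by 2.\<close>
  define c where "c = coeff f 0"
  define h where "h = f - smult c q"
  have degh: "degree h \<le> 2 * Suc m"
    unfolding h_def using Suc.prems(1) degq
    by (intro degree_diff_le) (auto intro: order.trans[OF degree_smult_le])
  have palh: "coeff h i = coeff h (2 * Suc m - i)" if "i \<le> 2 * Suc m" for i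
    using Suc.prems(2)[OF that] palq[OF that] by (simp add: h_def)
  have h0: "coeff h 0 = 0"
    using coeffq[of 0] by (simp add: h_def c_def)
  obtain g where g: "h = pCons 0 g"
    using h0 by (cases h) auto
  have palg: "coeff g i = coeff g (2 * m - i)" if "i \<le> 2 * m" for i
  proof -
    have "2 * Suc m - Suc i = Suc (2 * m - i)" using that by simp
    then show ?thesis
      using palh[of "Suc i"] that by (simp add: g)
  qed
  \<comment> \<open>The bound on \<open>degree h\<close> only excludes indices above
    \<open>2 * m + 1\<close>; the coefficient of \<open>g\<close> at that index is the mirror image
    of the constant coefficient of \<open>h\<close>.\<close>
  have "coeff g i = 0" if "i > 2 * m" for i
  proof (cases "i = Suc (2 * m)")
    case True
    then show ?thesis
      using palh[of "2 * Suc m"] h0 by (simp add: g)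
  next
    case False
    then have "Suc i > degree h" using that degh by simp
    then have "coeff h (Suc i) = 0" by (rule coeff_eq_0)
    then show ?thesis by (simp add: g)
  qed
  then have "degree g \<le> 2 * m"
    by (intro degree_le) auto
  from Suc.IH[OF this palg]
  obtain b where b: "g = (\<Sum>i\<le>m. smult (b i) ([:-1, 1:] ^ (2 * i) * monom 1 (m - i)))"
    by blast
  have "h = monom 1 1 * g"
    by (simp add: g monom_altdef)
  also have "\<dots> = (\<Sum>i\<le>m. smult (b i) ([:-1, 1:] ^ (2 * i) * monom 1 (Suc m - i)))"
    unfolding b sum_distrib_left
  proof (intro sum.cong refl)
    fix i assume "i \<in> {..m}"
    then have "monom 1 (Suc m - i) = monom 1 1 * (monom 1 (m - i) :: 'a poly)"
      by (simp add: mult_monom Suc_diff_le)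
    then show "monom 1 1 * smult (b i) ([:-1, 1:] ^ (2 * i) * monom 1 (m - i))
        = smult (b i) ([:-1, 1:] ^ (2 * i) * monom 1 (Suc m - i))"
      by (simp add: mult_ac)
  qed
  finally have "f = (\<Sum>i\<le>Suc m. smult ((b(Suc m := c)) i) ([:-1, 1:] ^ (2 * i) * monom 1 (Suc m - i)))"
    by (simp add: h_def q_def algebra_simps)
  then show ?case by blast
qed

section \<open>Derivatives at 1 as Taylor coefficients\<close>

lemma poly_higher_pderiv_eq_coeff_pcompose:
  fixes p :: "'a::{comm_ring_1,ring_no_zero_divisors,ring_char_0} poly"
  shows "poly ((pderiv ^^ j) p) c = fact j * coeff (pcompose p [:c, 1:]) j"
proof -
  \<comment> \<open>Differentiation commutes with the shift by \<open>c\<close>, because the inner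
    derivative is 1.\<close>
  have "(pderiv ^^ j) (pcompose p [:c, 1:]) = pcompose ((pderiv ^^ j) p) [:c, 1:]"
    by (induction j) (simp_all add: pderiv_pcompose pderiv_pCons)
  then have "poly ((pderiv ^^ j) p) c = coeff ((pderiv ^^ j) (pcompose p [:c, 1:])) 0"
    by (simp flip: poly_0_coeff_0 add: poly_pcompose)
  then show ?thesis
    by (simp add: coeff_higher_pderiv pochhammer_fact)
qed

lemma coeff_one_plus_X_power: "coeff ([:1, 1:] ^ n) j = (of_nat (n choose j) :: 'a::comm_semiring_1)"
proof (cases "j \<le> n")
  case True
  then show ?thesis by (simp add: coeff_linear_poly_power)
next
  case False
  have "degree ([:1, 1:] ^ n :: 'a poly) \<le> n"
    by (rule order.trans[OF degree_power_le]) simp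
  with False have "coeff ([:1, 1:] ^ n :: 'a poly) j = 0"
    by (intro coeff_eq_0) simp
  with False show ?thesis by (simp add: binomial_eq_0)
qed

text \<open>The shift x -> x + 1 turns the product into x^(2i) (x + 1)^n, whose coefficients are
  binomial.\<close>

lemma higher_pderiv_palindromic_basis:
  "poly ((pderiv ^^ j) ([:-1, 1:] ^ (2 * i) * monom 1 n)) (1::int)
    = (if j < 2 * i then 0 else fact j * int (n choose (j - 2 * i)))"
proof -
  have pow: "pcompose (p ^ l) r = pcompose p r ^ l" for p r :: "int poly" and l
    by (induction l) (simp_all add: pcompose_1 pcompose_mult)
  have "pcompose ([:-1, 1:] ^ (2 * i) * monom 1 n) [:1, 1:]
      = monom 1 (2 * i) * ([:1, 1:] ^ n :: int poly)"
    by (simp add: pcompose_mult pow monom_altdef pcompose_pCons)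
  then show ?thesis
    by (simp add: poly_higher_pderiv_eq_coeff_pcompose coeff_monom_mult coeff_one_plus_X_power)
qed

section \<open>Divisibility of falling factorials and of the basis derivatives\<close>

lemma fact_mult_binomial: "fact k * int (n choose k) = (\<Prod>t<k. int n - int t)"
proof -
  \<comment> \<open>The generalized binomial coefficient is a falling factorial for all
    \<open>n\<close> and \<open>k\<close>; if \<open>n < k\<close>, the factor \<open>t = n\<close>
    vanishes.\<close>
  have "real_of_int (fact k * int (n choose k)) = fact k * (real n gchoose k)"
    by (simp add: binomial_gbinomial)
  also have "\<dots> = (\<Prod>t<k. real n - real t)"
    by (simp add: gbinomial_mult_fact atLeast0LessThan)
  also have "\<dots> = real_of_int (\<Prod>t<k. int n - int t)"
    by simp
  finally show ?thesis by (simp only: of_int_eq_iff)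
qed

lemma middle_dvd_falling_factorial:
  "int n - int r dvd fact (2 * r + 1) * int (n choose (2 * r + 1))"
  unfolding fact_mult_binomial by (rule dvd_prodI) auto

text \<open>For \<open>r \<ge> 2\<close> the middle factor \<open>t = r\<close> is distinct from the
  factors \<open>t = 0\<close> and \<open>t = 1\<close>, whose product is even.\<close>

lemma twice_middle_dvd_falling_factorial:
  assumes "r \<ge> 2"
  shows "2 * (int n - int r) dvd fact (2 * r + 1) * int (n choose (2 * r + 1))"
proof -
  have split: "{..<2 * r + 1} = {0, 1} \<union> {2..<2 * r + 1}"
    using assms by auto
  have "(\<Prod>t<2 * r + 1. int n - int t)
      = (int n * (int n - 1)) * (\<Prod>t\<in>{2..<2 * r + 1}. int n - int t)"
    unfolding split by (subst prod.union_disjoint) auto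
  moreover have "2 dvd int n * (int n - 1)"
    by simp
  moreover have "int n - int r dvd (\<Prod>t\<in>{2..<2 * r + 1}. int n - int t)"
    using assms by (intro dvd_prodI) auto
  ultimately show ?thesis
    unfolding fact_mult_binomial by (metis mult_dvd_mono)
qed

text \<open>The last assumption excludes only \<open>i = 0\<close>, \<open>k = 1\<close>,
  \<open>m\<close> odd, where the value m (m - 1) (m - 2) need not be divisible by 2 (m - 1): take
  \<open>m = 3\<close>.\<close>

lemma higher_pderiv_palindromic_basis_dvd:
  assumes "i \<le> m" and "k \<ge> 1" and "i \<ge> 1 \<or> k \<ge> 2 \<or> even m"
  shows "2 * (int m - int k)
    dvd poly ((pderiv ^^ (2 * k + 1)) ([:-1, 1:] ^ (2 * i) * monom 1 (m - i))) 1"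
proof (cases "i \<le> k")
  case False
  then show ?thesis by (simp add: higher_pderiv_palindromic_basis del: funpow.simps)
next
  case True
  define r where "r = k - i"
  have r: "2 * k + 1 - 2 * i = 2 * r + 1" and mid: "int (m - i) - int r = int m - int k"
    using True assms(1) by (auto simp: r_def)
  have val: "poly ((pderiv ^^ (2 * k + 1)) ([:-1, 1:] ^ (2 * i) * monom 1 (m - i))) 1
      = fact (2 * k + 1) * int ((m - i) choose (2 * r + 1))"
    using True by (simp only: higher_pderiv_palindromic_basis r) simp
  consider "i \<ge> 1" | "i = 0" "k \<ge> 2" | "i = 0" "k = 1" "even m"
    using assms by linarith
  then show ?thesis
  proof cases
    case 1
    \<comment> \<open>Here r < k, so (2r+1)! already divides (2k-1)!, and the next factor 2k of
      (2k)! supplies the 2.\<close>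
    have "fact (2 * r + 1) dvd (fact (2 * k - 1) :: int)"
      using 1 True by (intro fact_dvd) (simp add: r_def)
    then have "2 * fact (2 * r + 1) dvd (int (2 * k) * fact (2 * k - 1))"
      by (intro mult_dvd_mono) simp_all
    also have "\<dots> = fact (2 * k)"
      using assms(2) by (subst (2) fact_reduce) auto
    also have "\<dots> dvd fact (2 * k + 1)"
      by (rule fact_dvd) simp
    finally have "2 * (fact (2 * r + 1) * int ((m - i) choose (2 * r + 1)))
        dvd fact (2 * k + 1) * int ((m - i) choose (2 * r + 1))"
      by (metis mult.assoc mult_dvd_mono dvd_refl)
    moreover have "2 * (int m - int k) dvd 2 * (fact (2 * r + 1) * int ((m - i) choose (2 * r + 1)))"
      using middle_dvd_falling_factorial[of "m - i" r] unfolding mid by (intro mult_dvd_mono) simp_all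
    ultimately show ?thesis
      unfolding val by (rule dvd_trans[rotated])
  next
    case 2
    then show ?thesis
      unfolding val using twice_middle_dvd_falling_factorial[of k m] by (simp only: r_def) simp
  next
    case 3
    have "fact 3 * int (m choose 3) = int m * (int m - 1) * (int m - 2)"
      unfolding fact_mult_binomial by (simp add: numeral_3_eq_3)
    moreover have "2 * (int m - 1) dvd int m * (int m - 1) * (int m - 2)"
      using 3 by (intro dvd_mult2 mult_dvd_mono) simp_all
    ultimately show ?thesis
      unfolding val using 3 by (simp add: r_def)
  qed
qed

text \<open>By linearity only the basis terms matter. The single term that may lack a factor 2 is
  \<open>i = 0\<close>; in the first claim doubling the derivative supplies it.\<close>

lemma palindromic_higher_pderiv_dvd:
  fixes f :: "int poly"
  assumes "degree f \<le> 2 * m"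
    and "\<And>i. i \<le> 2 * m \<Longrightarrow> coeff f i = coeff f (2 * m - i)"
    and "k \<ge> 1"
  shows "2 * (int m - int k) dvd 2 * poly ((pderiv ^^ (2 * k + 1)) f) 1"
    and "k \<ge> 2 \<or> even m \<Longrightarrow> 2 * (int m - int k) dvd poly ((pderiv ^^ (2 * k + 1)) f) 1"
proof -
  obtain b where b: "f = (\<Sum>i\<le>m. smult (b i) ([:-1, 1:] ^ (2 * i) * monom 1 (m - i)))"
    using palindromic_decomposition[OF assms(1,2)] by blast
  define D where "D = (\<lambda>i. poly ((pderiv ^^ (2 * k + 1)) ([:-1, 1:] ^ (2 * i) * monom 1 (m - i))) (1::int))"
  have eq: "poly ((pderiv ^^ (2 * k + 1)) f) 1 = (\<Sum>i\<le>m. b i * D i)"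
    unfolding b D_def by (simp only: higher_pderiv_sum higher_pderiv_smult poly_sum poly_smult)
  show "2 * (int m - int k) dvd poly ((pderiv ^^ (2 * k + 1)) f) 1" if "k \<ge> 2 \<or> even m"
    unfolding eq
    using that assms(3) higher_pderiv_palindromic_basis_dvd
    by (intro dvd_sum dvd_mult) (auto simp: D_def simp del: funpow.simps)
  have "2 * (int m - int k) dvd 2 * D i" if "i \<le> m" for i
  proof (cases "i = 0")
    case True
    then have "D i = fact (2 * k + 1) * int (m choose (2 * k + 1))"
      unfolding D_def by (simp only: higher_pderiv_palindromic_basis) simp
    then show ?thesis
      using middle_dvd_falling_factorial[of m k] by (simp only:) (intro mult_dvd_mono; simp)
  next
    case False
    then show ?thesis
      unfolding D_def using higher_pderiv_palindromic_basis_dvd[OF that assms(3)]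
      by (intro dvd_mult) simp
  qed
  then have "2 * (int m - int k) dvd (\<Sum>i\<le>m. b i * (2 * D i))"
    by (intro dvd_sum dvd_mult[of _ "2 * D _"]) auto
  then show "2 * (int m - int k) dvd 2 * poly ((pderiv ^^ (2 * k + 1)) f) 1"
    unfolding eq by (simp add: sum_distrib_left mult_ac)
qed

section \<open>Symmetry of the cyclotomic polynomials\<close>

lemma poly_cyclotomic_complex_1_neq_0:
  assumes "n \<ge> 2"
  shows "poly (cyclotomic_complex n) 1 \<noteq> 0"
proof -
  have "cis (2 * pi * real k / real n) \<noteq> 1" if "k \<in> totatives n" for k
  proof
    assume "cis (2 * pi * real k / real n) = 1"
    then have "cis (2 * pi * real k / real n) = cis (2 * pi * real 0 / real n)"
      by simp
    \<comment> \<open>The bound \<open>k < n\<close> fails for \<open>n = 1\<close>, where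
      \<open>k = 1\<close> is a totative and the root is 1.\<close>
    moreover have "k < n" "k > 0"
      using that assms totatives_less[of k n] by (auto simp: in_totatives_iff)
    ultimately show False
      using bij_betw_roots_unity[of n] assms
      by (auto simp: bij_betw_def dest: inj_onD[where x = k and y = 0])
  qed
  then show ?thesis
    by (auto simp: cyclotomic_complex_def poly_prod)
qed

text \<open>
  Inverting the roots permutes them, so reflection multiplies \<open>\<Phi>\<^sub>n\<close> by a constant. The constant
  is \<open>1\<close> because reflection does not change the value at \<open>1\<close>, which is nonzero.
\<close>

lemma reflect_cyclotomic_complex:
  assumes "n \<ge> 2"
  shows "reflect_poly (cyclotomic_complex n) = cyclotomic_complex n"
proof -
  define z where "z = (\<lambda>k. cis (2 * pi * real k / real n))"
  have z_minus: "z (n - k) = inverse (z k)" if "k \<le> n" for k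
  proof -
    have "2 * pi * real (n - k) / real n = 2 * pi - 2 * pi * real k / real n"
      using that assms by (simp add: of_nat_diff field_simps)
    then show ?thesis
      by (simp add: z_def cis_divide[symmetric] inverse_eq_divide)
  qed
  \<comment> \<open>Reversing x - z gives 1 - z x = -z (x - 1/z).\<close>
  have reflect: "reflect_poly [:- z k, 1:] = smult (- z k) [:- inverse (z k), 1:]" for k
    by (simp add: z_def reflect_poly_pCons cis_mult)
  have "reflect_poly (cyclotomic_complex n)
      = (\<Prod>k\<in>totatives n. smult (- z k) [:- inverse (z k), 1:])"
    by (simp only: cyclotomic_complex_def reflect_poly_prod reflect[unfolded z_def] z_def)
  also have "\<dots> = smult (\<Prod>k\<in>totatives n. - z k) (\<Prod>k\<in>totatives n. [:- inverse (z k), 1:])"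
    by (rule prod_smult)
  \<comment> \<open>The involution k -> n - k of the totatives inverts the roots.\<close>
  also have "(\<Prod>k\<in>totatives n. [:- inverse (z k), 1:]) = (\<Prod>k\<in>totatives n. [:- z k, 1:])"
  proof (rule prod.reindex_bij_witness[of _ "\<lambda>k. n - k" "\<lambda>k. n - k"])
    fix k assume k: "k \<in> totatives n"
    then have le: "k < n" "k > 0" "coprime k n"
      using assms totatives_less[of k n] by (auto simp: in_totatives_iff)
    then show "n - (n - k) = k" by simp
    then show "n - (n - k) = k" .
    have "coprime (n - k) n"
      using le by (metis coprime_iff_gcd_eq_1 gcd_diff2_nat less_imp_le_nat)
    then show "n - k \<in> totatives n"
      using le by (simp add: in_totatives_iff)
    then show "n - k \<in> totatives n" .
    show "[:- z (n - k), 1:] = [:- inverse (z k), 1:]"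
      using z_minus le by simp
  qed
  finally have eq: "reflect_poly (cyclotomic_complex n)
      = smult (\<Prod>k\<in>totatives n. - z k) (cyclotomic_complex n)"
    by (simp add: cyclotomic_complex_def z_def)
  have "poly (reflect_poly (cyclotomic_complex n)) 1 = poly (cyclotomic_complex n) 1"
    by (simp add: poly_reflect_poly_nz)
  then have "(\<Prod>k\<in>totatives n. - z k) = 1"
    using poly_cyclotomic_complex_1_neq_0[OF assms] unfolding eq by simp
  then show ?thesis
    using eq by simp
qed

lemma coeff_cyclotomic_symmetric:
  assumes "n \<ge> 2" and "i \<le> totient n"
  shows "coeff (cyclotomic n) i = coeff (cyclotomic n) (totient n - i)"
proof -
  have coeff: "coeff (cyclotomic_complex n) j = of_int (coeff (cyclotomic n) j)" for j
    by (simp add: coeff_map_poly flip: of_int_cyclotomic)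
  have "coeff (cyclotomic_complex n) i = coeff (cyclotomic_complex n) (totient n - i)"
    using coeff_reflect_poly[of "cyclotomic_complex n" i] assms
    by (simp add: reflect_cyclotomic_complex degree_cyclotomic_complex)
  then show ?thesis
    by (simp add: coeff)
qed

theorem theorem2p7:
  fixes n :: nat
  assumes "n \<ge> 1"
  shows "(int (totient n) - 2 dvd 2 * poly ((pderiv ^^ 3) (cyclotomic n)) 1 \<and>
          (4 dvd totient n \<longrightarrow>
            int (totient n) - 2 dvd poly ((pderiv ^^ 3) (cyclotomic n)) 1)) \<and>
         (\<forall>k::nat. k \<ge> 2 \<longrightarrow>
            int (totient n) - 2 * int k dvd poly ((pderiv ^^ (2 * k + 1)) (cyclotomic n)) 1)"
proof (cases "n > 2")
  case False
  \<comment> \<open>These polynomials have odd degree 1, so the expansion does not apply, but all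
    derivatives in question vanish.\<close>
  then have "n = 1 \<or> n = 2"
    using assms by auto
  then have "totient n = 1"
    by auto
  then have "poly ((pderiv ^^ j) (cyclotomic n)) 1 = 0" if "j \<ge> 2" for j
    using that
    by (simp add: poly_higher_pderiv_eq_coeff_pcompose coeff_eq_0 degree_pcompose degree_cyclotomic)
  then show ?thesis by (simp del: funpow.simps)
next
  case True
  obtain m where m: "totient n = 2 * m"
    using totient_even[OF True] by blast
  have deg: "degree (cyclotomic n) \<le> 2 * m"
    by (simp add: degree_cyclotomic m)
  have sym: "coeff (cyclotomic n) i = coeff (cyclotomic n) (2 * m - i)" if "i \<le> 2 * m" for i
    using coeff_cyclotomic_symmetric[of n i] that True by (simp add: m)
  have "int (totient n) - 2 * int k = 2 * (int m - int k)" for k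
    by (simp add: m)
  \<comment> \<open>This matches the parity condition for \<open>k = 1\<close>, the third
    derivative; for \<open>k \<ge> 2\<close> no parity of \<open>m\<close> enters.\<close>
  moreover have "4 dvd totient n \<longleftrightarrow> even m"
    unfolding m by presburger
  ultimately show ?thesis
    using palindromic_higher_pderiv_dvd[OF deg sym, of 1] palindromic_higher_pderiv_dvd(2)[OF deg sym]
    by (auto simp del: funpow.simps simp: numeral_3_eq_3)
qed

end
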